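(* If $\mathcal{B}$ is a locally ordered Cartesian bicategory, then the bicategory of modules $\mathbf{Mod}\mathcal{B}$ is a locally ordered Cartesian bicategory too.
   Context: A locally ordered bicategory is a bicategory in which every hom-category is a partially ordered set (antisymmetric), with 2-cells written $\le$; it is in particular a 2-category. A tensor product on $\mathcal B$ is a pseudofunctor $\otimes:\mathcal B\times\mathcal B\to\mathcal B$ with an object $I$ and natural isomorphisms $\rho:X\to X\otimes I$, $\lambda:X\to I\otimes X$, $\gamma:X\otimes Y\to Y\otimes X$, $\alpha:(X\otimes Y)\otimes Z\to X\otimes(Y\otimes Z)$ satisfying the usual coherence conditions of a symmetric monoidal structure (pentagon, unit triangle, hexagon, $\gamma\gamma=1$). $\mathcal B$ is Cartesian (has a Cartesian structure) if it has a tensor product and every object $X$ has a cocommutative comonoid structure $d_X:X\to X\otimes X$, $t_X:X\to I$ (i.e. $(X\otimes d_X)d_X=\alpha(d_X\otimes X)d_X$, $(X\otimes t_X)d_X=\rho$, $(t_X\otimes X)d_X=\lambda$, $\gamma d_X=d_X$) such that: (1) for each arrow $F:X\to Y$, $d_YF\le(F\otimes F)d_X$ and $t_YF\le t_X$; (2) $d_X$ and $t_X$ have right adjoints $d_X^*$, $t_X^*$. In a locally ordered bicategory a monad $(A,a)$ is an arrow $a:A\to A$ with $1_A\le a$ and $aa\le a$. A module $m:(A,a)\to(B,b)$ is an arrow $m:A\to B$ with $ma\le m$ and $bm\le m$. $\mathbf{Mod}\mathcal B$ has monads as objects, modules as arrows, and the inequalities of $\mathcal B$ as 2-cells; composition is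 that of $\mathcal B$ and the identity on $(A,a)$ is $a$. *)

theory Defs
  imports Main
begin

section \<open>Locally ordered bicategories\<close>

text \<open>
  Arrows carry their domain and codomain, so hom-sets are pairwise disjoint.  The relation
  \<open>Le\<close> is the relation ``there is a 2-cell'' and is only ever used between parallel arrows.
\<close>

record ('o, 'a) bicat =
  Obj :: "'o set"
  Arr :: "'a set"
  Dom :: "'a \<Rightarrow> 'o"
  Cod :: "'a \<Rightarrow> 'o"
  Idt :: "'o \<Rightarrow> 'a" ("\<one>\<index>")
  Comp :: "'a \<Rightarrow> 'a \<Rightarrow> 'a" (infixl "\<cdot>\<index>" 70)
  Le :: "'a \<Rightarrow> 'a \<Rightarrow> bool" (infix "\<sqsubseteq>\<index>" 50)

definition hom :: "('o, 'a, 'm) bicat_scheme \<Rightarrow> 'o \<Rightarrow> 'o \<Rightarrow> 'a set" where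
  "hom B X Y = {f \<in> Arr B. Dom B f = X \<and> Cod B f = Y}"

text \<open>
  The hom-categories are posets, so an invertible 2-cell is an equality and every diagram of
  2-cells commutes.  Hence the unit and associativity constraints of the bicategory are
  equations, and functoriality of horizontal composition is monotonicity.
\<close>

locale locally_ordered_bicategory =
  fixes B :: "('o, 'a, 'm) bicat_scheme" (structure)
  assumes dom_obj: "f \<in> Arr B \<Longrightarrow> Dom B f \<in> Obj B"
    and cod_obj: "f \<in> Arr B \<Longrightarrow> Cod B f \<in> Obj B"
    and id_hom: "X \<in> Obj B \<Longrightarrow> \<one> X \<in> hom B X X"
    and comp_hom: "\<lbrakk>f \<in> hom B X Y; g \<in> hom B Y Z\<rbrakk> \<Longrightarrow> g \<cdot> f \<in> hom B X Z"
    and comp_id_right: "f \<in> hom B X Y \<Longrightarrow> f \<cdot> \<one> X = f"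
    and comp_id_left: "f \<in> hom B X Y \<Longrightarrow> \<one> Y \<cdot> f = f"
    and comp_assoc: "\<lbrakk>f \<in> hom B W X; g \<in> hom B X Y; h \<in> hom B Y Z\<rbrakk>
          \<Longrightarrow> (h \<cdot> g) \<cdot> f = h \<cdot> (g \<cdot> f)"
    and le_refl: "f \<in> hom B X Y \<Longrightarrow> f \<sqsubseteq> f"
    and le_trans: "\<lbrakk>f \<in> hom B X Y; g \<in> hom B X Y; h \<in> hom B X Y; f \<sqsubseteq> g; g \<sqsubseteq> h\<rbrakk>
          \<Longrightarrow> f \<sqsubseteq> h"
    and le_antisym: "\<lbrakk>f \<in> hom B X Y; g \<in> hom B X Y; f \<sqsubseteq> g; g \<sqsubseteq> f\<rbrakk> \<Longrightarrow> f = g"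
    and comp_mono: "\<lbrakk>f \<in> hom B X Y; f' \<in> hom B X Y; g \<in> hom B Y Z; g' \<in> hom B Y Z;
            f \<sqsubseteq> f'; g \<sqsubseteq> g'\<rbrakk> \<Longrightarrow> g \<cdot> f \<sqsubseteq> g' \<cdot> f'"

definition right_adjoint ::
    "('o, 'a, 'm) bicat_scheme \<Rightarrow> 'o \<Rightarrow> 'o \<Rightarrow> 'a \<Rightarrow> 'a \<Rightarrow> bool" where
  "right_adjoint B X Y f g \<longleftrightarrow> f \<in> hom B X Y \<and> g \<in> hom B Y X
     \<and> \<one>\<^bsub>B\<^esub> X \<sqsubseteq>\<^bsub>B\<^esub> g \<cdot>\<^bsub>B\<^esub> f \<and> f \<cdot>\<^bsub>B\<^esub> g \<sqsubseteq>\<^bsub>B\<^esub> \<one>\<^bsub>B\<^esub> Y"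

definition isomorphism ::
    "('o, 'a, 'm) bicat_scheme \<Rightarrow> 'o \<Rightarrow> 'o \<Rightarrow> 'a \<Rightarrow> bool" where
  "isomorphism B X Y f \<longleftrightarrow> f \<in> hom B X Y
     \<and> (\<exists>g \<in> hom B Y X. g \<cdot>\<^bsub>B\<^esub> f = \<one>\<^bsub>B\<^esub> X \<and> f \<cdot>\<^bsub>B\<^esub> g = \<one>\<^bsub>B\<^esub> Y)"

definition prod_bicat ::
    "('o, 'a, 'm) bicat_scheme \<Rightarrow> ('p, 'b, 'n) bicat_scheme \<Rightarrow> ('o \<times> 'p, 'a \<times> 'b) bicat" where
  "prod_bicat B C =
    \<lparr>Obj = Obj B \<times> Obj C,
     Arr = Arr B \<times> Arr C,
     Dom = map_prod (Dom B) (Dom C),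
     Cod = map_prod (Cod B) (Cod C),
     Idt = map_prod (Idt B) (Idt C),
     Comp = (\<lambda>(g, g') (f, f'). (g \<cdot>\<^bsub>B\<^esub> f, g' \<cdot>\<^bsub>C\<^esub> f')),
     Le = (\<lambda>(f, f') (g, g'). f \<sqsubseteq>\<^bsub>B\<^esub> g \<and> f' \<sqsubseteq>\<^bsub>C\<^esub> g')\<rparr>"

lemma hom_prod_bicat:
  "hom (prod_bicat B C) X Y = hom B (fst X) (fst Y) \<times> hom C (snd X) (snd Y)"
  by (cases X; cases Y) (auto simp: hom_def prod_bicat_def)

lemma locally_ordered_bicategory_prod_bicat:
  assumes "locally_ordered_bicategory B" and "locally_ordered_bicategory C"
  shows "locally_ordered_bicategory (prod_bicat B C)"
proof -
  interpret B: locally_ordered_bicategory B by fact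
  interpret C: locally_ordered_bicategory C by fact
  show ?thesis
    by (rule locally_ordered_bicategory.intro; (unfold hom_prod_bicat)?)
      (auto simp: prod_bicat_def B.dom_obj B.cod_obj C.dom_obj C.cod_obj
        B.comp_id_left B.comp_id_right C.comp_id_left C.comp_id_right
        B.comp_assoc C.comp_assoc
        intro: B.id_hom C.id_hom B.comp_hom C.comp_hom B.le_refl C.le_refl
          B.le_trans C.le_trans B.le_antisym C.le_antisym B.comp_mono C.comp_mono)
qed


section \<open>Pseudofunctors and natural isomorphisms\<close>

text \<open>
  The comparison 2-cells of a pseudofunctor are invertible, hence equalities here, and their
  coherence axioms are automatic.  The same applies to the naturality 2-cells of a
  pseudonatural transformation.
\<close>

locale pseudofunctor =
  B: locally_ordered_bicategory B + C: locally_ordered_bicategory C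
  for B :: "('o, 'a, 'm) bicat_scheme" and C :: "('p, 'b, 'n) bicat_scheme" +
  fixes FO :: "'o \<Rightarrow> 'p" and FA :: "'a \<Rightarrow> 'b"
  assumes map_obj: "X \<in> Obj B \<Longrightarrow> FO X \<in> Obj C"
    and map_hom: "f \<in> hom B X Y \<Longrightarrow> FA f \<in> hom C (FO X) (FO Y)"
    and map_le: "\<lbrakk>f \<in> hom B X Y; g \<in> hom B X Y; f \<sqsubseteq>\<^bsub>B\<^esub> g\<rbrakk> \<Longrightarrow> FA f \<sqsubseteq>\<^bsub>C\<^esub> FA g"
    and map_id: "X \<in> Obj B \<Longrightarrow> FA (\<one>\<^bsub>B\<^esub> X) = \<one>\<^bsub>C\<^esub> (FO X)"
    and map_comp: "\<lbrakk>f \<in> hom B X Y; g \<in> hom B Y Z\<rbrakk>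
          \<Longrightarrow> FA (g \<cdot>\<^bsub>B\<^esub> f) = FA g \<cdot>\<^bsub>C\<^esub> FA f"

locale natural_isomorphism =
  F: pseudofunctor B C FO FA + G: pseudofunctor B C GO GA
  for B :: "('o, 'a, 'm) bicat_scheme" and C :: "('p, 'b, 'n) bicat_scheme"
    and FO FA GO GA +
  fixes \<eta> :: "'o \<Rightarrow> 'b"
  assumes component: "X \<in> Obj B \<Longrightarrow> isomorphism C (FO X) (GO X) (\<eta> X)"
    and natural: "f \<in> hom B X Y \<Longrightarrow> \<eta> Y \<cdot>\<^bsub>C\<^esub> FA f = GA f \<cdot>\<^bsub>C\<^esub> \<eta> X"


section \<open>Tensor products and Cartesian structures\<close>

locale tensor_product = locally_ordered_bicategory B
  for B :: "('o, 'a, 'm) bicat_scheme" (structure) +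
  fixes tensor_obj :: "'o \<Rightarrow> 'o \<Rightarrow> 'o" (infixl "\<odot>" 75)
    and tensor_arr :: "'a \<Rightarrow> 'a \<Rightarrow> 'a" (infixl "\<otimes>" 75)
    and I :: 'o
    and \<rho> :: "'o \<Rightarrow> 'a"
    and l :: "'o \<Rightarrow> 'a"
    and \<gamma> :: "'o \<Rightarrow> 'o \<Rightarrow> 'a"
    and \<alpha> :: "'o \<Rightarrow> 'o \<Rightarrow> 'o \<Rightarrow> 'a"
  assumes unit_obj: "I \<in> Obj B"
    and tensor: "pseudofunctor (prod_bicat B B) B
          (\<lambda>(X, Y). X \<odot> Y) (\<lambda>(F, G). F \<otimes> G)"
    and rho: "natural_isomorphism B B
          (\<lambda>X. X) (\<lambda>F. F)
          (\<lambda>X. X \<odot> I) (\<lambda>F. F \<otimes> \<one> I) \<rho>"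
    and lambda: "natural_isomorphism B B
          (\<lambda>X. X) (\<lambda>F. F)
          (\<lambda>X. I \<odot> X) (\<lambda>F. \<one> I \<otimes> F) l"
    and gamma: "natural_isomorphism (prod_bicat B B) B
          (\<lambda>(X, Y). X \<odot> Y) (\<lambda>(F, G). F \<otimes> G)
          (\<lambda>(X, Y). Y \<odot> X) (\<lambda>(F, G). G \<otimes> F) (\<lambda>(X, Y). \<gamma> X Y)"
    and alpha: "natural_isomorphism (prod_bicat (prod_bicat B B) B) B
          (\<lambda>((X, Y), Z). (X \<odot> Y) \<odot> Z) (\<lambda>((F, G), H). (F \<otimes> G) \<otimes> H)
          (\<lambda>((X, Y), Z). X \<odot> (Y \<odot> Z)) (\<lambda>((F, G), H). F \<otimes> (G \<otimes> H))
          (\<lambda>((X, Y), Z). \<alpha> X Y Z)"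
    and pentagon: "\<lbrakk>W \<in> Obj B; X \<in> Obj B; Y \<in> Obj B; Z \<in> Obj B\<rbrakk> \<Longrightarrow>
          \<alpha> W X (Y \<odot> Z) \<cdot> \<alpha> (W \<odot> X) Y Z
            = (\<one> W \<otimes> \<alpha> X Y Z) \<cdot> \<alpha> W (X \<odot> Y) Z \<cdot> (\<alpha> W X Y \<otimes> \<one> Z)"
    and triangle: "\<lbrakk>X \<in> Obj B; Y \<in> Obj B\<rbrakk> \<Longrightarrow>
          \<alpha> X I Y \<cdot> (\<rho> X \<otimes> \<one> Y) = \<one> X \<otimes> l Y"
    and hexagon: "\<lbrakk>X \<in> Obj B; Y \<in> Obj B; Z \<in> Obj B\<rbrakk> \<Longrightarrow>
          \<alpha> Y Z X \<cdot> \<gamma> X (Y \<odot> Z) \<cdot> \<alpha> X Y Z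
            = (\<one> Y \<otimes> \<gamma> X Z) \<cdot> \<alpha> Y X Z \<cdot> (\<gamma> X Y \<otimes> \<one> Z)"
    and symmetry: "\<lbrakk>X \<in> Obj B; Y \<in> Obj B\<rbrakk> \<Longrightarrow> \<gamma> Y X \<cdot> \<gamma> X Y = \<one> (X \<odot> Y)"

locale cartesian_structure =
  tensor_product B tensor_obj tensor_arr I \<rho> l \<gamma> \<alpha>
  for B :: "('o, 'a, 'm) bicat_scheme" (structure)
    and tensor_obj (infixl "\<odot>" 75) and tensor_arr (infixl "\<otimes>" 75)
    and I \<rho> l \<gamma> \<alpha> +
  fixes d :: "'o \<Rightarrow> 'a" and t :: "'o \<Rightarrow> 'a"
  assumes d_hom: "X \<in> Obj B \<Longrightarrow> d X \<in> hom B X (X \<odot> X)"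
    and t_hom: "X \<in> Obj B \<Longrightarrow> t X \<in> hom B X I"
    and coassociative: "X \<in> Obj B \<Longrightarrow>
          (\<one> X \<otimes> d X) \<cdot> d X = \<alpha> X X X \<cdot> (d X \<otimes> \<one> X) \<cdot> d X"
    and counit_right: "X \<in> Obj B \<Longrightarrow> (\<one> X \<otimes> t X) \<cdot> d X = \<rho> X"
    and counit_left: "X \<in> Obj B \<Longrightarrow> (t X \<otimes> \<one> X) \<cdot> d X = l X"
    and cocommutative: "X \<in> Obj B \<Longrightarrow> \<gamma> X X \<cdot> d X = d X"
    and d_lax: "F \<in> hom B X Y \<Longrightarrow> d Y \<cdot> F \<sqsubseteq> (F \<otimes> F) \<cdot> d X"
    and t_lax: "F \<in> hom B X Y \<Longrightarrow> t Y \<cdot> F \<sqsubseteq> t X"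
    and d_right_adjoint: "X \<in> Obj B \<Longrightarrow> \<exists>g. right_adjoint B X (X \<odot> X) (d X) g"
    and t_right_adjoint: "X \<in> Obj B \<Longrightarrow> \<exists>g. right_adjoint B X I (t X) g"

definition locally_ordered_cartesian_bicategory :: "('o, 'a, 'm) bicat_scheme \<Rightarrow> bool" where
  "locally_ordered_cartesian_bicategory B \<longleftrightarrow> locally_ordered_bicategory B \<and>
     (\<exists>tensor_obj tensor_arr I \<rho> l \<gamma> \<alpha> d t.
        cartesian_structure B tensor_obj tensor_arr I \<rho> l \<gamma> \<alpha> d t)"


section \<open>Monads and modules\<close>

definition monad :: "('o, 'a, 'm) bicat_scheme \<Rightarrow> 'o \<times> 'a \<Rightarrow> bool" where
  "monad B = (\<lambda>(A, a). A \<in> Obj B \<and> a \<in> hom B A A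
     \<and> \<one>\<^bsub>B\<^esub> A \<sqsubseteq>\<^bsub>B\<^esub> a \<and> a \<cdot>\<^bsub>B\<^esub> a \<sqsubseteq>\<^bsub>B\<^esub> a)"

definition is_module :: "('o, 'a, 'm) bicat_scheme \<Rightarrow> 'o \<times> 'a \<Rightarrow> 'o \<times> 'a \<Rightarrow> 'a \<Rightarrow> bool" where
  "is_module B = (\<lambda>(A, a) (A', b) m. m \<in> hom B A A'
     \<and> m \<cdot>\<^bsub>B\<^esub> a \<sqsubseteq>\<^bsub>B\<^esub> m \<and> b \<cdot>\<^bsub>B\<^esub> m \<sqsubseteq>\<^bsub>B\<^esub> m)"

text \<open>
  One arrow \<open>m\<close> of \<open>B\<close> may be a module between several pairs of monads, so an arrow of the
  bicategory of modules records \<open>m\<close> together with its domain and codomain.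
\<close>

definition Mod :: "('o, 'a, 'm) bicat_scheme
    \<Rightarrow> ('o \<times> 'a, ('o \<times> 'a) \<times> 'a \<times> ('o \<times> 'a)) bicat" where
  "Mod B =
    \<lparr>Obj = {P. monad B P},
     Arr = {(P, m, Q). monad B P \<and> monad B Q \<and> is_module B P Q m},
     Dom = (\<lambda>(P, m, Q). P),
     Cod = (\<lambda>(P, m, Q). Q),
     Idt = (\<lambda>(A, a). ((A, a), a, (A, a))),
     Comp = (\<lambda>(Q, n, R) (P, m, Q'). (P, n \<cdot>\<^bsub>B\<^esub> m, R)),
     Le = (\<lambda>(P, m, Q) (P', n, Q'). m \<sqsubseteq>\<^bsub>B\<^esub> n)\<rparr>"

end

theory Submission
  imports Defs
begin

text \<open>
  A map of monads \<open>f : (A, a) \<rightarrow> (B, b)\<close>, i.e. an arrow with \<open>f \<cdot> a \<sqsubseteq> b \<cdot> f\<close>, induces the module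
  \<open>b \<cdot> f\<close>, functorially and compatibly with the pointwise tensor product.  The constraints of
  the tensor product are maps of monads by naturality, and so are \<open>d\<close> and \<open>t\<close> by laxness;
  hence all coherence equations carry over from \<open>B\<close> to the modules.  If \<open>g\<close> is right adjoint
  to \<open>f\<close> then \<open>g \<cdot> b\<close> is a module, and it is right adjoint to \<open>b \<cdot> f\<close>.
\<close>

section \<open>Bifunctors\<close>

lemma Obj_prod_bicat: "Obj (prod_bicat B C) = Obj B \<times> Obj C"
  and Idt_prod_bicat: "Idt (prod_bicat B C) (X, Y) = (Idt B X, Idt C Y)"
  and Comp_prod_bicat: "Comp (prod_bicat B C) (g, g') (f, f') = (Comp B g f, Comp C g' f')"
  and Le_prod_bicat: "Le (prod_bicat B C) (f, f') (g, g') \<longleftrightarrow> Le B f g \<and> Le C f' g'"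
  by (auto simp: prod_bicat_def)

lemmas prod_bicat_simps =
  Obj_prod_bicat Idt_prod_bicat Comp_prod_bicat Le_prod_bicat hom_prod_bicat

text \<open>Isolates the functorial part of a tensor product. Each constraint in
  \<open>tensor_product\<close> must come with pseudofunctors as source and target; deriving these
  from the tensor alone makes the same lemmas available for \<open>B\<close> and for
  \<open>Mod B\<close>.\<close>

locale bifunctor =
  locally_ordered_bicategory B for B :: "('o, 'a, 'm) bicat_scheme" (structure) +
  fixes tensor_obj :: "'o \<Rightarrow> 'o \<Rightarrow> 'o" (infixl "\<odot>" 75)
    and tensor_arr :: "'a \<Rightarrow> 'a \<Rightarrow> 'a" (infixl "\<otimes>" 75)
  assumes tensor_pseudofunctor: "pseudofunctor (prod_bicat B B) B
    (\<lambda>(X, Y). X \<odot> Y) (\<lambda>(F, G). F \<otimes> G)"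
begin

lemma obj_tensor: "\<lbrakk>X \<in> Obj B; Y \<in> Obj B\<rbrakk> \<Longrightarrow> X \<odot> Y \<in> Obj B"
  using pseudofunctor.map_obj[OF tensor_pseudofunctor, of "(X, Y)"]
  by (simp add: prod_bicat_simps)

lemma tensor_hom:
  "\<lbrakk>f \<in> hom B X X'; g \<in> hom B Y Y'\<rbrakk> \<Longrightarrow> f \<otimes> g \<in> hom B (X \<odot> Y) (X' \<odot> Y')"
  using pseudofunctor.map_hom[OF tensor_pseudofunctor, of "(f, g)" "(X, Y)" "(X', Y')"]
  by (simp add: prod_bicat_simps)

lemma tensor_le:
  "\<lbrakk>f \<in> hom B X X'; f' \<in> hom B X X'; g \<in> hom B Y Y'; g' \<in> hom B Y Y'; f \<sqsubseteq> f'; g \<sqsubseteq> g'\<rbrakk>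
    \<Longrightarrow> f \<otimes> g \<sqsubseteq> f' \<otimes> g'"
  using pseudofunctor.map_le[OF tensor_pseudofunctor, of "(f, g)" "(X, Y)" "(X', Y')"
      "(f', g')"]
  by (simp add: prod_bicat_simps)

lemma tensor_id: "\<lbrakk>X \<in> Obj B; Y \<in> Obj B\<rbrakk> \<Longrightarrow> \<one> X \<otimes> \<one> Y = \<one> (X \<odot> Y)"
  using pseudofunctor.map_id[OF tensor_pseudofunctor, of "(X, Y)"]
  by (simp add: prod_bicat_simps)

lemma tensor_comp:
  "\<lbrakk>f \<in> hom B X Y; f' \<in> hom B Y Z; g \<in> hom B X' Y'; g' \<in> hom B Y' Z'\<rbrakk>
    \<Longrightarrow> (f' \<cdot> f) \<otimes> (g' \<cdot> g) = (f' \<otimes> g') \<cdot> (f \<otimes> g)"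
  using pseudofunctor.map_comp[OF tensor_pseudofunctor, of "(f, g)" "(X, X')" "(Y, Y')"
      "(f', g')" "(Z, Z')"]
  by (simp add: prod_bicat_simps)

lemma bicategory_prod2: "locally_ordered_bicategory (prod_bicat B B)"
  and bicategory_prod3: "locally_ordered_bicategory (prod_bicat (prod_bicat B B) B)"
  by (intro locally_ordered_bicategory_prod_bicat locally_ordered_bicategory_axioms)+

lemmas tensor_facts =
  obj_tensor tensor_hom tensor_le tensor_id tensor_comp id_hom comp_hom le_refl

section \<open>Sources and targets of the constraints as pseudofunctors\<close>

lemma pseudofunctor_id: "pseudofunctor B B (\<lambda>X. X) (\<lambda>F. F)"
  by unfold_locales auto

lemma pseudofunctor_tensor_right:
  assumes "J \<in> Obj B"
  shows "pseudofunctor B B (\<lambda>X. X \<odot> J) (\<lambda>F. F \<otimes> \<one> J)"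
proof -
  have "(g \<cdot> f) \<otimes> \<one> J = (g \<otimes> \<one> J) \<cdot> (f \<otimes> \<one> J)" if "f \<in> hom B X Y" "g \<in> hom B Y Z" for f g X Y Z
    \<comment> \<open>The constant factor \<open>\<one> J\<close> is read as
      \<open>\<one> J \<cdot> \<one> J\<close>, so that interchange applies.\<close>
    using tensor_comp[OF that id_hom id_hom, of J] assms comp_id_left[OF id_hom] by simp
  then show ?thesis
    by unfold_locales (use assms in \<open>auto intro: tensor_facts\<close>)
qed

lemma pseudofunctor_tensor_left:
  assumes "J \<in> Obj B"
  shows "pseudofunctor B B (\<lambda>X. J \<odot> X) (\<lambda>F. \<one> J \<otimes> F)"
proof -
  have "\<one> J \<otimes> (g \<cdot> f) = (\<one> J \<otimes> g) \<cdot> (\<one> J \<otimes> f)" if "f \<in> hom B X Y" "g \<in> hom B Y Z" for f g X Y Z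
    using tensor_comp[OF id_hom id_hom that, of J] assms comp_id_left[OF id_hom] by simp
  then show ?thesis
    by unfold_locales (use assms in \<open>auto intro: tensor_facts\<close>)
qed

lemma pseudofunctor_tensor_swap:
  "pseudofunctor (prod_bicat B B) B (\<lambda>(X, Y). Y \<odot> X) (\<lambda>(F, G). G \<otimes> F)"
  by (intro pseudofunctor.intro pseudofunctor_axioms.intro bicategory_prod2
      locally_ordered_bicategory_axioms)
    (auto simp: prod_bicat_simps intro: tensor_facts)

lemma pseudofunctor_tensor_left_nested:
  "pseudofunctor (prod_bicat (prod_bicat B B) B) B
    (\<lambda>((X, Y), Z). (X \<odot> Y) \<odot> Z) (\<lambda>((F, G), H). (F \<otimes> G) \<otimes> H)"
  \<comment> \<open>Interchange is applied twice. After the inner use the factors are tensors, whose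
    typing is not among the hypotheses; the instance with \<open>tensor_hom\<close> reduces it to
    the typing of \<open>F\<close>, \<open>G\<close> and their successors.\<close>
  by (intro pseudofunctor.intro pseudofunctor_axioms.intro bicategory_prod3
      locally_ordered_bicategory_axioms)
    (auto simp: prod_bicat_simps tensor_id obj_tensor
      tensor_comp tensor_comp[OF tensor_hom tensor_hom]
      intro!: obj_tensor tensor_hom tensor_le)

lemma pseudofunctor_tensor_right_nested:
  "pseudofunctor (prod_bicat (prod_bicat B B) B) B
    (\<lambda>((X, Y), Z). X \<odot> (Y \<odot> Z)) (\<lambda>((F, G), H). F \<otimes> (G \<otimes> H))"
  by (intro pseudofunctor.intro pseudofunctor_axioms.intro bicategory_prod3
      locally_ordered_bicategory_axioms)
    (auto simp: prod_bicat_simps tensor_id obj_tensor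
      tensor_comp tensor_comp[OF _ _ tensor_hom tensor_hom]
      intro!: obj_tensor tensor_hom tensor_le)

end


section \<open>The bicategory of modules\<close>

lemma Obj_Mod: "P \<in> Obj (Mod B) \<longleftrightarrow> monad B P"
  and Idt_Mod: "Idt (Mod B) P = (P, snd P, P)"
  and Comp_Mod: "Comp (Mod B) (Q, n, R) (P, m, Q') = (P, Comp B n m, R)"
  and Le_Mod: "Le (Mod B) (P, m, Q) (P', n, Q') \<longleftrightarrow> Le B m n"
  by (auto simp: Mod_def split: prod.split)

lemma hom_Mod:
  "x \<in> hom (Mod B) P Q \<longleftrightarrow>
    monad B P \<and> monad B Q \<and> (\<exists>m. x = (P, m, Q) \<and> is_module B P Q m)"
  by (cases x) (auto simp: hom_def Mod_def)

context locally_ordered_bicategory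
begin

lemma comp_le_left: "\<lbrakk>f \<in> hom B X Y; g \<in> hom B Y Z; g' \<in> hom B Y Z; g \<sqsubseteq> g'\<rbrakk> \<Longrightarrow> g \<cdot> f \<sqsubseteq> g' \<cdot> f"
  by (rule comp_mono) (auto intro: le_refl)

lemma comp_le_right: "\<lbrakk>f \<in> hom B X Y; f' \<in> hom B X Y; g \<in> hom B Y Z; f \<sqsubseteq> f'\<rbrakk> \<Longrightarrow> g \<cdot> f \<sqsubseteq> g \<cdot> f'"
  by (rule comp_mono) (auto intro: le_refl)

section \<open>Monads and modules described by equations\<close>

lemma monad_obj: "monad B P \<Longrightarrow> fst P \<in> Obj B"
  and monad_hom: "monad B P \<Longrightarrow> snd P \<in> hom B (fst P) (fst P)"
  and monad_unit: "monad B P \<Longrightarrow> \<one> (fst P) \<sqsubseteq> snd P"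
  and monad_mult: "monad B P \<Longrightarrow> snd P \<cdot> snd P \<sqsubseteq> snd P"
  by (auto simp: monad_def)

text \<open>The unit of the monad whiskered with \<open>f\<close>. This bound and its mirror image
  \<open>le_comp_monad\<close> supply the converses of the multiplication and action
  inequalities.\<close>

lemma le_monad_comp:
  assumes "monad B P" and "f \<in> hom B X (fst P)"
  shows "f \<sqsubseteq> snd P \<cdot> f"
  using comp_le_left[OF assms(2) id_hom[OF monad_obj] monad_hom monad_unit] assms
  by (simp add: comp_id_left)

lemma le_comp_monad:
  assumes "monad B P" and "f \<in> hom B (fst P) X"
  shows "f \<sqsubseteq> f \<cdot> snd P"
  using comp_le_right[OF id_hom[OF monad_obj] monad_hom assms(2) monad_unit] assms
  by (simp add: comp_id_right)

lemma monad_idem: "monad B P \<Longrightarrow> snd P \<cdot> snd P = snd P"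
  by (rule le_antisym[where X = "fst P" and Y = "fst P"])
    (auto intro: comp_hom monad_hom monad_mult le_monad_comp)

text \<open>The unit of each monad gives the converse of the action inequality, so by antisymmetry
  modules absorb their monads exactly. Later arguments can therefore rewrite with equations.\<close>

lemma is_module_iff:
  assumes "monad B P" and "monad B Q"
  shows "is_module B P Q m \<longleftrightarrow>
    m \<in> hom B (fst P) (fst Q) \<and> m \<cdot> snd P = m \<and> snd Q \<cdot> m = m"
proof -
  have "m \<cdot> snd P = m" if "m \<in> hom B (fst P) (fst Q)" "m \<cdot> snd P \<sqsubseteq> m"
    using that assms by (blast intro: le_antisym comp_hom monad_hom le_comp_monad)
  moreover have "snd Q \<cdot> m = m" if "m \<in> hom B (fst P) (fst Q)" "snd Q \<cdot> m \<sqsubseteq> m"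
    using that assms by (blast intro: le_antisym comp_hom monad_hom le_monad_comp)
  ultimately show ?thesis
    by (auto simp: is_module_def case_prod_beta intro: le_refl)
qed

lemma hom_ModD:
  assumes "x \<in> hom (Mod B) P Q"
  obtains m where "x = (P, m, Q)" "monad B P" "monad B Q" "m \<in> hom B (fst P) (fst Q)"
    "m \<cdot> snd P = m" "snd Q \<cdot> m = m"
  using assms by (auto simp: hom_Mod is_module_iff)

lemma hom_ModI:
  "\<lbrakk>monad B P; monad B Q; m \<in> hom B (fst P) (fst Q); m \<cdot> snd P = m; snd Q \<cdot> m = m\<rbrakk>
    \<Longrightarrow> (P, m, Q) \<in> hom (Mod B) P Q"
  by (auto simp: hom_Mod is_module_iff)

text \<open>Serves where the action is known only as an inequality, as for the module
  \<open>g \<cdot> snd Q\<close> obtained from a right adjoint.\<close>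

lemma hom_ModI_le:
  "\<lbrakk>monad B P; monad B Q; m \<in> hom B (fst P) (fst Q); m \<cdot> snd P \<sqsubseteq> m; snd Q \<cdot> m \<sqsubseteq> m\<rbrakk>
    \<Longrightarrow> (P, m, Q) \<in> hom (Mod B) P Q"
  by (auto simp: hom_Mod is_module_def split: prod.splits)

lemma Mod_comp_hom:
  assumes "x \<in> hom (Mod B) P Q" and "y \<in> hom (Mod B) Q R"
  shows "Comp (Mod B) y x \<in> hom (Mod B) P R"
proof -
  obtain m where m: "x = (P, m, Q)" "monad B P" "m \<in> hom B (fst P) (fst Q)" "m \<cdot> snd P = m"
    using assms(1) by (elim hom_ModD)
  obtain n where n: "y = (Q, n, R)" "monad B R" "n \<in> hom B (fst Q) (fst R)" "snd R \<cdot> n = n"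
    using assms(2) by (elim hom_ModD)
  have "(n \<cdot> m) \<cdot> snd P = n \<cdot> m" "snd R \<cdot> (n \<cdot> m) = n \<cdot> m"
    using comp_assoc[OF monad_hom[OF m(2)] m(3) n(3)] m(4)
      comp_assoc[OF m(3) n(3) monad_hom[OF n(2)]] n(4) by auto
  with m n show ?thesis
    by (auto simp: Comp_Mod intro: hom_ModI comp_hom)
qed

text \<open>Associativity, the order laws and monotonicity are inherited from \<open>B\<close>. The
  identity is the monad itself: it is a module by idempotence, and its unit laws are the two action
  equations.\<close>

lemma locally_ordered_bicategory_Mod: "locally_ordered_bicategory (Mod B)"
proof unfold_locales
  fix f assume "f \<in> Arr (Mod B)"
  then show "Dom (Mod B) f \<in> Obj (Mod B)" "Cod (Mod B) f \<in> Obj (Mod B)"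
    by (auto simp: Mod_def)
next
  fix W X Y Z f g h
  assume "f \<in> hom (Mod B) W X" "g \<in> hom (Mod B) X Y" "h \<in> hom (Mod B) Y Z"
  then show "Comp (Mod B) (Comp (Mod B) h g) f = Comp (Mod B) h (Comp (Mod B) g f)"
    by (elim hom_ModD) (simp add: Comp_Mod comp_assoc)
next
  fix X Y f g h
  assume "f \<in> hom (Mod B) X Y" "g \<in> hom (Mod B) X Y" "h \<in> hom (Mod B) X Y"
    "Le (Mod B) f g" "Le (Mod B) g h"
  then show "Le (Mod B) f h"
    by (elim hom_ModD) (auto simp: Le_Mod intro: le_trans)
next
  fix X Y Z f f' g g'
  assume "f \<in> hom (Mod B) X Y" "f' \<in> hom (Mod B) X Y" "g \<in> hom (Mod B) Y Z"
    "g' \<in> hom (Mod B) Y Z" "Le (Mod B) f f'" "Le (Mod B) g g'"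
  then show "Le (Mod B) (Comp (Mod B) g f) (Comp (Mod B) g' f')"
    by (elim hom_ModD) (auto simp: Le_Mod Comp_Mod intro: comp_mono)
next
  fix X
  assume "X \<in> Obj (Mod B)"
  then show "Idt (Mod B) X \<in> hom (Mod B) X X"
    by (simp add: Obj_Mod Idt_Mod hom_ModI monad_hom monad_idem)
next
  fix X Y Z f g
  assume "f \<in> hom (Mod B) X Y" "g \<in> hom (Mod B) Y Z"
  then show "Comp (Mod B) g f \<in> hom (Mod B) X Z"
    by (rule Mod_comp_hom)
next
  fix X Y f
  assume f: "f \<in> hom (Mod B) X Y"
  then show "Comp (Mod B) f (Idt (Mod B) X) = f" "Comp (Mod B) (Idt (Mod B) Y) f = f"
    by (auto simp: Idt_Mod Comp_Mod elim: hom_ModD)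
  from f show "Le (Mod B) f f"
    by (elim hom_ModD) (auto simp: Le_Mod intro: le_refl)
next
  fix X Y f g
  assume "f \<in> hom (Mod B) X Y" "g \<in> hom (Mod B) X Y" "Le (Mod B) f g" "Le (Mod B) g f"
  then show "f = g"
    by (elim hom_ModD) (auto simp: Le_Mod intro: le_antisym)
qed

section \<open>Maps of monads and the modules they induce\<close>

definition monad_map :: "'o \<times> 'a \<Rightarrow> 'o \<times> 'a \<Rightarrow> 'a \<Rightarrow> bool" where
  "monad_map P Q f \<longleftrightarrow> monad B P \<and> monad B Q \<and> f \<in> hom B (fst P) (fst Q)
    \<and> f \<cdot> snd P \<sqsubseteq> snd Q \<cdot> f"

text \<open>If monads are thought of as categories and maps of monads as functors, this is the
  representable module \<open>f_*\<close> of the functor \<open>f\<close>.\<close>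

definition sharp :: "'o \<times> 'a \<Rightarrow> 'o \<times> 'a \<Rightarrow> 'a \<Rightarrow> ('o \<times> 'a) \<times> 'a \<times> ('o \<times> 'a)" where
  "sharp P Q f = (P, snd Q \<cdot> f, Q)"

lemma monad_mapD:
  assumes "monad_map P Q f"
  shows "monad B P" "monad B Q" "f \<in> hom B (fst P) (fst Q)" "f \<cdot> snd P \<sqsubseteq> snd Q \<cdot> f"
  using assms by (auto simp: monad_map_def)

lemma monad_map_eqI:
  "\<lbrakk>monad B P; monad B Q; f \<in> hom B (fst P) (fst Q); f \<cdot> snd P = snd Q \<cdot> f\<rbrakk> \<Longrightarrow> monad_map P Q f"
  using le_refl[OF comp_hom[OF _ monad_hom]] by (auto simp: monad_map_def)

lemma monad_map_id: "monad B P \<Longrightarrow> monad_map P P (\<one> (fst P))"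
  by (simp add: monad_map_eqI id_hom monad_obj comp_id_left[OF monad_hom]
      comp_id_right[OF monad_hom])

text \<open>The two squares are pasted: with monads \<open>a\<close>, \<open>b\<close>,
  \<open>c\<close> on \<open>P\<close>, \<open>Q\<close>, \<open>R\<close>, the chain is
  \<open>g f a \<le> g b f \<le> c g f\<close>.\<close>

lemma monad_map_comp:
  assumes f: "monad_map P Q f" and g: "monad_map Q R g"
  shows "monad_map P R (g \<cdot> f)"
proof -
  note f = monad_mapD[OF f] and g = monad_mapD[OF g]
  note a = monad_hom[OF f(1)] and b = monad_hom[OF f(2)] and c = monad_hom[OF g(2)]
  have "(g \<cdot> f) \<cdot> snd P = g \<cdot> (f \<cdot> snd P)"
    by (rule comp_assoc[OF a f(3) g(3)])
  moreover have "g \<cdot> (f \<cdot> snd P) \<sqsubseteq> g \<cdot> (snd Q \<cdot> f)"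
    using f a b g by (intro comp_le_right[OF _ _ g(3)] comp_hom)
  moreover have "g \<cdot> (snd Q \<cdot> f) = (g \<cdot> snd Q) \<cdot> f"
    by (rule comp_assoc[OF f(3) b g(3), symmetric])
  moreover have "(g \<cdot> snd Q) \<cdot> f \<sqsubseteq> (snd R \<cdot> g) \<cdot> f"
    using f g b c by (intro comp_le_left[OF f(3)] comp_hom)
  moreover have "(snd R \<cdot> g) \<cdot> f = snd R \<cdot> (g \<cdot> f)"
    by (rule comp_assoc[OF f(3) g(3) c])
  moreover have "g \<cdot> (f \<cdot> snd P) \<in> hom B (fst P) (fst R)"
    "g \<cdot> (snd Q \<cdot> f) \<in> hom B (fst P) (fst R)" "snd R \<cdot> (g \<cdot> f) \<in> hom B (fst P) (fst R)"
    using f g a b c by (blast intro: comp_hom)+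
  ultimately show ?thesis
    using f g by (auto simp: monad_map_def intro: comp_hom le_trans)
qed

text \<open>With monads \<open>a\<close> and \<open>b\<close>, moving \<open>a\<close> across
  \<open>f\<close> gives \<open>b f a \<le> b b f = b f\<close>; the unit of \<open>a\<close> gives
  the converse. This is the right action on \<open>sharp P Q f\<close>.\<close>

lemma sharp_absorb:
  assumes "monad_map P Q f"
  shows "(snd Q \<cdot> f) \<cdot> snd P = snd Q \<cdot> f"
proof -
  note f = monad_mapD[OF assms]
  note a = monad_hom[OF f(1)] and b = monad_hom[OF f(2)]
  have "snd Q \<cdot> (f \<cdot> snd P) \<sqsubseteq> snd Q \<cdot> (snd Q \<cdot> f)"
    using f a b by (intro comp_le_right[OF _ _ b] comp_hom)
  then have "(snd Q \<cdot> f) \<cdot> snd P \<sqsubseteq> snd Q \<cdot> f"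
    using comp_assoc[OF a f(3) b] comp_assoc[OF f(3) b b] monad_idem[OF f(2)] by simp
  with f a b show ?thesis
    by (intro le_antisym[where X = "fst P" and Y = "fst Q"] comp_hom le_comp_monad)
qed

lemma sharp_hom:
  assumes "monad_map P Q f"
  shows "sharp P Q f \<in> hom (Mod B) P Q"
proof -
  note f = monad_mapD[OF assms]
  note b = monad_hom[OF f(2)]
  show ?thesis
    unfolding sharp_def
    using f b sharp_absorb[OF assms] comp_assoc[OF f(3) b b] monad_idem[OF f(2)]
    by (auto intro: hom_ModI comp_hom)
qed

text \<open>The monad of \<open>Q\<close> standing between \<open>g\<close> and \<open>f\<close> is
  absorbed by \<open>snd R \<cdot> g\<close> from the right, by \<open>sharp_absorb\<close>. With
  \<open>sharp_id\<close> this makes \<open>sharp\<close> functorial.\<close>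

lemma sharp_comp:
  assumes f: "monad_map P Q f" and g: "monad_map Q R g"
  shows "Comp (Mod B) (sharp Q R g) (sharp P Q f) = sharp P R (g \<cdot> f)"
proof -
  note f = monad_mapD[OF f] and g' = monad_mapD[OF g]
  note b = monad_hom[OF f(2)] and c = monad_hom[OF g'(2)]
  have "(snd R \<cdot> g) \<cdot> (snd Q \<cdot> f) = (snd R \<cdot> g) \<cdot> f"
    using comp_assoc[OF f(3) b comp_hom[OF g'(3) c]] sharp_absorb[OF g] by simp
  also have "\<dots> = snd R \<cdot> (g \<cdot> f)"
    by (rule comp_assoc[OF f(3) g'(3) c])
  finally show ?thesis
    by (simp add: sharp_def Comp_Mod)
qed

lemma sharp_id: "monad B P \<Longrightarrow> sharp P P (\<one> (fst P)) = Idt (Mod B) P"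
  by (simp add: sharp_def Idt_Mod comp_id_right[OF monad_hom])

text \<open>Threefold composites occur in the pentagon, the hexagon and coassociativity.\<close>

lemma sharp_comp3:
  assumes "monad_map P Q f" and "monad_map Q R g" and "monad_map R S h"
  shows "Comp (Mod B) (Comp (Mod B) (sharp R S h) (sharp Q R g)) (sharp P Q f)
    = sharp P S (h \<cdot> g \<cdot> f)"
  using assms by (simp add: sharp_comp[of Q R g] sharp_comp[OF _ monad_map_comp])

text \<open>The module \<open>n\<close> absorbs the monad of \<open>Q\<close> inside
  \<open>sharp\<close>. On the other side, in \<open>sharp_comp_module\<close>, the monad stays in
  front; \<open>module_comp_absorb\<close> reconciles the two forms.\<close>

lemma module_comp_sharp:
  assumes n: "(Q, n, Q') \<in> hom (Mod B) Q Q'" and f: "monad_map P Q f"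
  shows "Comp (Mod B) (Q, n, Q') (sharp P Q f) = (P, n \<cdot> f, Q')"
proof -
  have n: "n \<in> hom B (fst Q) (fst Q')" "n \<cdot> snd Q = n"
    using n by (auto elim: hom_ModD)
  note f = monad_mapD[OF f]
  show ?thesis
    using comp_assoc[OF f(3) monad_hom[OF f(2)] n(1)] n(2) by (simp add: sharp_def Comp_Mod)
qed

lemma sharp_comp_module:
  assumes m: "(P, m, P') \<in> hom (Mod B) P P'" and f: "monad_map P' Q f"
  shows "Comp (Mod B) (sharp P' Q f) (P, m, P') = (P, snd Q \<cdot> (f \<cdot> m), Q)"
proof -
  have m: "m \<in> hom B (fst P) (fst P')"
    using m by (auto elim: hom_ModD)
  note f = monad_mapD[OF f]
  show ?thesis
    using comp_assoc[OF m f(3) monad_hom[OF f(2)]] by (simp add: sharp_def Comp_Mod)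
qed

lemma module_comp_absorb:
  assumes "(Q, n, Q') \<in> hom (Mod B) Q Q'" and "f \<in> hom B X (fst Q)"
  shows "snd Q' \<cdot> (n \<cdot> f) = n \<cdot> f"
proof -
  have n: "monad B Q'" "n \<in> hom B (fst Q) (fst Q')" "snd Q' \<cdot> n = n"
    using assms(1) by (auto elim: hom_ModD)
  show ?thesis
    using comp_assoc[OF assms(2) n(2) monad_hom[OF n(1)]] n(3) by simp
qed

text \<open>A commuting square in \<open>B\<close> is multiplied on the left by the monad of
  \<open>Q'\<close>, which \<open>n\<close> then absorbs. This lifts naturality of the constraints
  to modules.\<close>

lemma sharp_natural:
  assumes "(P, m, P') \<in> hom (Mod B) P P'" and "(Q, n, Q') \<in> hom (Mod B) Q Q'"
    and "monad_map P Q f" and "monad_map P' Q' f'" and "f' \<cdot> m = n \<cdot> f"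
  shows "Comp (Mod B) (sharp P' Q' f') (P, m, P') = Comp (Mod B) (Q, n, Q') (sharp P Q f)"
  using assms monad_mapD[OF assms(3)]
  by (simp add: module_comp_sharp sharp_comp_module module_comp_absorb)

text \<open>The argument of \<open>sharp_natural\<close> with a 2-cell in place of the equation,
  whiskered with the monad of \<open>Q'\<close>.\<close>

lemma sharp_lax:
  assumes m: "(P, m, P') \<in> hom (Mod B) P P'" and n: "(Q, n, Q') \<in> hom (Mod B) Q Q'"
    and f: "monad_map P Q f" and f': "monad_map P' Q' f'" and le: "f' \<cdot> m \<sqsubseteq> n \<cdot> f"
  shows "Le (Mod B) (Comp (Mod B) (sharp P' Q' f') (P, m, P'))
    (Comp (Mod B) (Q, n, Q') (sharp P Q f))"
proof -
  have hom: "m \<in> hom B (fst P) (fst P')" "n \<in> hom B (fst Q) (fst Q')" "monad B Q'"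
    using m n by (auto elim: hom_ModD)
  have "snd Q' \<cdot> (f' \<cdot> m) \<sqsubseteq> snd Q' \<cdot> (n \<cdot> f)"
    using comp_le_right[OF comp_hom[OF hom(1) monad_mapD(3)[OF f']]
        comp_hom[OF monad_mapD(3)[OF f] hom(2)] monad_hom[OF hom(3)] le] .
  then show ?thesis
    using m n f f' monad_mapD[OF f]
    by (simp add: module_comp_sharp sharp_comp_module module_comp_absorb Le_Mod)
qed

text \<open>The inverse \<open>g\<close> must be a map of monads too. Conjugating a mere inequality
  by \<open>g\<close> would give the wrong direction for it, so commutation is required as an
  equation. Functoriality of \<open>sharp\<close> then carries the inverse laws over.\<close>

lemma sharp_isomorphism:
  assumes P: "monad B P" and Q: "monad B Q"
    and f: "isomorphism B (fst P) (fst Q) f" and eq: "f \<cdot> snd P = snd Q \<cdot> f"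
  shows "isomorphism (Mod B) P Q (sharp P Q f)"
proof -
  obtain g where g: "g \<in> hom B (fst Q) (fst P)" "g \<cdot> f = \<one> (fst P)" "f \<cdot> g = \<one> (fst Q)"
    and f: "f \<in> hom B (fst P) (fst Q)"
    using f by (auto simp: isomorphism_def)
  note a = monad_hom[OF P] and b = monad_hom[OF Q]
  \<comment> \<open>The identity \<open>f \<cdot> g\<close> is inserted on the right; once the monad
    has been moved across \<open>f\<close>, the identity \<open>g \<cdot> f\<close> cancels on the
    left.\<close>
  have "g \<cdot> snd Q = (g \<cdot> snd Q) \<cdot> (f \<cdot> g)"
    using comp_id_right[OF comp_hom[OF b g(1)]] g(3) by simp
  also have "\<dots> = (g \<cdot> (snd Q \<cdot> f)) \<cdot> g"
    using comp_assoc[OF g(1) f comp_hom[OF b g(1)]] comp_assoc[OF f b g(1)] by simp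
  also have "\<dots> = (g \<cdot> f \<cdot> snd P) \<cdot> g"
    using comp_assoc[OF a f g(1)] eq by simp
  also have "\<dots> = snd P \<cdot> g"
    using comp_id_left[OF a] g(2) by simp
  finally have g': "monad_map Q P g"
    using P Q g by (intro monad_map_eqI)
  have f': "monad_map P Q f"
    using P Q f eq by (intro monad_map_eqI)
  show ?thesis
    unfolding isomorphism_def
    using sharp_hom[OF f'] sharp_hom[OF g'] sharp_comp[OF f' g'] sharp_comp[OF g' f']
      sharp_id[OF P] sharp_id[OF Q] g by auto
qed

lemma sharp_right_adjoint:
  assumes f: "monad_map P Q f" and adj: "right_adjoint B (fst P) (fst Q) f g"
  shows "right_adjoint (Mod B) P Q (sharp P Q f) (Q, g \<cdot> snd Q, P)"
proof -
  note sf = sharp_hom[OF f] and f = monad_mapD[OF f]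
  let ?a = "snd P" and ?b = "snd Q" and ?A = "fst P" and ?B = "fst Q"
  note a = monad_hom[OF f(1)] and b = monad_hom[OF f(2)]
  have g: "g \<in> hom B ?B ?A" "\<one> ?A \<sqsubseteq> g \<cdot> f" "f \<cdot> g \<sqsubseteq> \<one> ?B"
    using adj by (auto simp: right_adjoint_def)
  note hom = f(3) g(1) a b
  \<comment> \<open>From \<open>a \<le> g f a \<le> g b f\<close>, using the unit of the adjunction
    in \<open>B\<close> and then the map of monads. It becomes the unit of the adjunction in
    \<open>Mod B\<close>.\<close>
  have 1: "?a \<sqsubseteq> g \<cdot> (?b \<cdot> f)"
  proof -
    have "\<one> ?A \<cdot> ?a \<sqsubseteq> (g \<cdot> f) \<cdot> ?a"
      by (rule comp_le_left[OF a _ _ g(2)]) (blast intro: comp_hom hom id_hom monad_obj f)+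
    moreover have "g \<cdot> (f \<cdot> ?a) \<sqsubseteq> g \<cdot> (?b \<cdot> f)"
      by (rule comp_le_right[OF _ _ g(1) f(4)]) (blast intro: comp_hom hom)+
    ultimately show ?thesis
      using comp_id_left[OF a] comp_assoc[OF a f(3) g(1)] hom
      by (auto intro: le_trans[where X = ?A and Y = ?A] comp_hom)
  qed
  \<comment> \<open>The mate of \<open>f a \<le> b f\<close> under the adjunction, obtained as
    \<open>a g \<le> g b f g \<le> g b\<close> from the previous bound and the counit. It provides
    the left action on \<open>g b\<close>.\<close>
  have ag: "?a \<cdot> g \<sqsubseteq> g \<cdot> ?b"
  proof -
    have "?a \<cdot> g \<sqsubseteq> (g \<cdot> (?b \<cdot> f)) \<cdot> g"
      by (rule comp_le_left[OF g(1) a _ 1]) (blast intro: comp_hom hom)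
    moreover have "(g \<cdot> (?b \<cdot> f)) \<cdot> g = (g \<cdot> ?b) \<cdot> (f \<cdot> g)"
      using comp_assoc[OF f(3) b g(1)] comp_assoc[OF g(1) f(3) comp_hom[OF b g(1)]] by simp
    moreover have "(g \<cdot> ?b) \<cdot> (f \<cdot> g) \<sqsubseteq> (g \<cdot> ?b) \<cdot> \<one> ?B"
      by (rule comp_le_right[OF comp_hom[OF g(1) f(3)] id_hom[OF monad_obj[OF f(2)]]
            comp_hom[OF b g(1)] g(3)])
    moreover have "(g \<cdot> ?b) \<cdot> \<one> ?B = g \<cdot> ?b"
      by (rule comp_id_right[OF comp_hom[OF b g(1)]])
    ultimately show ?thesis
      using le_trans[OF comp_hom[OF g(1) a] comp_hom[OF comp_hom[OF g(1) f(3)] comp_hom[OF b g(1)]]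
          comp_hom[OF b g(1)]]
      by simp
  qed
  have bb: "(g \<cdot> ?b) \<cdot> ?b = g \<cdot> ?b"
    using comp_assoc[OF b b g(1)] monad_idem[OF f(2)] by simp
  have gb: "(Q, g \<cdot> ?b, P) \<in> hom (Mod B) Q P"
  proof (rule hom_ModI_le)
    show "(g \<cdot> ?b) \<cdot> ?b \<sqsubseteq> g \<cdot> ?b"
      using bb le_refl comp_hom[OF b g(1)] by simp
    have "(?a \<cdot> g) \<cdot> ?b \<sqsubseteq> (g \<cdot> ?b) \<cdot> ?b"
      by (rule comp_le_left[OF b comp_hom[OF g(1) a] comp_hom[OF b g(1)] ag])
    then show "?a \<cdot> (g \<cdot> ?b) \<sqsubseteq> g \<cdot> ?b"
      using bb comp_assoc[OF b g(1) a] by simp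
  qed (use f hom in \<open>auto intro: comp_hom\<close>)
  have "(g \<cdot> ?b) \<cdot> (?b \<cdot> f) = g \<cdot> (?b \<cdot> f)"
    using comp_assoc[OF f(3) b comp_hom[OF b g(1)]] comp_assoc[OF f(3) b g(1)] bb by simp
  \<comment> \<open>The counit in \<open>Mod B\<close>: the counit in \<open>B\<close> removes
    \<open>f g\<close> from between the two copies of \<open>b\<close>, and
    \<open>b b = b\<close>.\<close>
  moreover have "(?b \<cdot> f) \<cdot> (g \<cdot> ?b) \<sqsubseteq> ?b"
  proof -
    have "(f \<cdot> g) \<cdot> ?b \<sqsubseteq> \<one> ?B \<cdot> ?b"
      by (rule comp_le_left[OF b comp_hom[OF g(1) f(3)] id_hom[OF monad_obj[OF f(2)]] g(3)])
    then have "?b \<cdot> ((f \<cdot> g) \<cdot> ?b) \<sqsubseteq> ?b \<cdot> ?b"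
      using comp_le_right[OF comp_hom[OF b comp_hom[OF g(1) f(3)]] b b] comp_id_left[OF b] by simp
    then show ?thesis
      using comp_assoc[OF comp_hom[OF b g(1)] f(3) b] comp_assoc[OF b g(1) f(3)]
        monad_idem[OF f(2)] by simp
  qed
  ultimately show ?thesis
    using 1 sf gb by (auto simp: right_adjoint_def sharp_def Comp_Mod Idt_Mod Le_Mod)
qed

end


section \<open>The tensor product of modules\<close>

context tensor_product
begin

sublocale bifunctor B tensor_obj tensor_arr
  by (intro bifunctor.intro bifunctor_axioms.intro tensor locally_ordered_bicategory_axioms)

definition mtensor_obj (infixl "\<odot>\<^sub>M" 75) where
  "P \<odot>\<^sub>M Q = (fst P \<odot> fst Q, snd P \<otimes> snd Q)"

definition mtensor_arr (infixl "\<otimes>\<^sub>M" 75) where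
  "x \<otimes>\<^sub>M y = (fst x \<odot>\<^sub>M fst y, fst (snd x) \<otimes> fst (snd y), snd (snd x) \<odot>\<^sub>M snd (snd y))"

definition munit ("I\<^sub>M") where
  "I\<^sub>M = (I, \<one> I)"

lemma mtensor_obj_simps [simp]: "fst (P \<odot>\<^sub>M Q) = fst P \<odot> fst Q" "snd (P \<odot>\<^sub>M Q) = snd P \<otimes> snd Q"
  by (auto simp: mtensor_obj_def)

lemma mtensor_arr_simp [simp]: "(P, m, P') \<otimes>\<^sub>M (Q, n, Q') = (P \<odot>\<^sub>M Q, m \<otimes> n, P' \<odot>\<^sub>M Q')"
  by (simp add: mtensor_arr_def)

lemma munit_simps [simp]: "fst I\<^sub>M = I" "snd I\<^sub>M = \<one> I"
  by (auto simp: munit_def)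

lemma monad_munit: "monad B I\<^sub>M"
  using unit_obj id_hom[OF unit_obj]
  by (simp add: monad_def munit_def comp_id_left le_refl)

text \<open>The unit comes from monotonicity of the tensor, the multiplication from interchange:
  \<open>(a \<otimes> b) \<cdot> (a \<otimes> b) = (a \<cdot> a) \<otimes> (b \<cdot>
  b)\<close>.\<close>

lemma monad_mtensor:
  assumes "monad B P" and "monad B Q"
  shows "monad B (P \<odot>\<^sub>M Q)"
proof -
  note a = monad_obj[OF assms(1)] monad_hom[OF assms(1)]
  note b = monad_obj[OF assms(2)] monad_hom[OF assms(2)]
  have "\<one> (fst P) \<otimes> \<one> (fst Q) \<sqsubseteq> snd P \<otimes> snd Q"
    using a b assms by (blast intro: tensor_le id_hom monad_unit)
  moreover have "(snd P \<cdot> snd P) \<otimes> (snd Q \<cdot> snd Q) = snd P \<otimes> snd Q"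
    using assms by (simp add: monad_idem)
  ultimately show ?thesis
    using a b tensor_comp[OF a(2) a(2) b(2) b(2)]
    by (simp add: monad_def case_prod_beta obj_tensor tensor_hom tensor_id le_refl[OF tensor_hom])
qed

lemma module_mtensor:
  assumes "x \<in> hom (Mod B) P P'" and "y \<in> hom (Mod B) Q Q'"
  shows "x \<otimes>\<^sub>M y \<in> hom (Mod B) (P \<odot>\<^sub>M Q) (P' \<odot>\<^sub>M Q')"
proof -
  obtain m where m: "x = (P, m, P')" "monad B P" "monad B P'" "m \<in> hom B (fst P) (fst P')"
    "m \<cdot> snd P = m" "snd P' \<cdot> m = m"
    using assms(1) by (elim hom_ModD)
  obtain n where n: "y = (Q, n, Q')" "monad B Q" "monad B Q'" "n \<in> hom B (fst Q) (fst Q')"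
    "n \<cdot> snd Q = n" "snd Q' \<cdot> n = n"
    using assms(2) by (elim hom_ModD)
  have "(m \<otimes> n) \<cdot> (snd P \<otimes> snd Q) = m \<otimes> n" "(snd P' \<otimes> snd Q') \<cdot> (m \<otimes> n) = m \<otimes> n"
    using tensor_comp[OF monad_hom[OF m(2)] m(4) monad_hom[OF n(2)] n(4)]
      tensor_comp[OF m(4) monad_hom[OF m(3)] n(4) monad_hom[OF n(3)]] m n by auto
  with m n show ?thesis
    by (auto intro!: hom_ModI monad_mtensor tensor_hom)
qed

text \<open>Composition and order of modules are those of \<open>B\<close>, so interchange and
  monotonicity carry over. Identities are preserved by definition: both sides have the underlying
  arrow \<open>snd P \<otimes> snd Q\<close>.\<close>

lemma bifunctor_Mod: "bifunctor (Mod B) (\<odot>\<^sub>M) (\<otimes>\<^sub>M)"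
proof -
  interpret M: locally_ordered_bicategory "Mod B"
    by (rule locally_ordered_bicategory_Mod)
  show ?thesis
  proof (intro bifunctor.intro bifunctor_axioms.intro pseudofunctor.intro
      pseudofunctor_axioms.intro locally_ordered_bicategory_prod_bicat
      M.locally_ordered_bicategory_axioms)
    fix f g X Y
    assume "f \<in> hom (prod_bicat (Mod B) (Mod B)) X Y" "g \<in> hom (prod_bicat (Mod B) (Mod B)) X Y"
      "Le (prod_bicat (Mod B) (Mod B)) f g"
    then show "Le (Mod B) (case f of (F, G) \<Rightarrow> F \<otimes>\<^sub>M G) (case g of (F, G) \<Rightarrow> F \<otimes>\<^sub>M G)"
      by (clarsimp simp: prod_bicat_simps)
        (elim hom_ModD; auto simp: Le_Mod intro: tensor_le)
  next
    fix f g X Y Z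
    assume "f \<in> hom (prod_bicat (Mod B) (Mod B)) X Y" "g \<in> hom (prod_bicat (Mod B) (Mod B)) Y Z"
    then show "(case Comp (prod_bicat (Mod B) (Mod B)) g f of (F, G) \<Rightarrow> F \<otimes>\<^sub>M G)
      = Comp (Mod B) (case g of (F, G) \<Rightarrow> F \<otimes>\<^sub>M G) (case f of (F, G) \<Rightarrow> F \<otimes>\<^sub>M G)"
      by (clarsimp simp: prod_bicat_simps)
        (elim hom_ModD; auto simp: Comp_Mod intro: tensor_comp)
  qed (auto simp: prod_bicat_simps Obj_Mod Idt_Mod intro: monad_mtensor module_mtensor)
qed

lemma monad_map_tensor:
  assumes f: "monad_map P Q f" and g: "monad_map P' Q' g"
  shows "monad_map (P \<odot>\<^sub>M P') (Q \<odot>\<^sub>M Q') (f \<otimes> g)"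
proof -
  note f = monad_mapD[OF f] and g = monad_mapD[OF g]
  note a = monad_hom[OF f(1)] monad_hom[OF f(2)] monad_hom[OF g(1)] monad_hom[OF g(2)]
  have "(f \<cdot> snd P) \<otimes> (g \<cdot> snd P') \<sqsubseteq> (snd Q \<cdot> f) \<otimes> (snd Q' \<cdot> g)"
    using comp_hom[OF a(1) f(3)] comp_hom[OF f(3) a(2)] comp_hom[OF a(3) g(3)]
      comp_hom[OF g(3) a(4)] f(4) g(4) by (rule tensor_le)
  then show ?thesis
    using tensor_comp[OF a(1) f(3) a(3) g(3)] tensor_comp[OF f(3) a(2) g(3) a(4)] f g
    by (simp add: monad_map_def monad_mtensor tensor_hom)
qed

text \<open>Interchange collects the two monads in front. Tensors inside coherence equations thereby
  become tensors in \<open>B\<close>.\<close>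

lemma sharp_tensor:
  assumes f: "monad_map P Q f" and g: "monad_map P' Q' g"
  shows "sharp P Q f \<otimes>\<^sub>M sharp P' Q' g = sharp (P \<odot>\<^sub>M P') (Q \<odot>\<^sub>M Q') (f \<otimes> g)"
proof -
  note f = monad_mapD[OF f] and g = monad_mapD[OF g]
  show ?thesis
    using tensor_comp[OF f(3) monad_hom[OF f(2)] g(3) monad_hom[OF g(2)]]
    by (simp add: sharp_def)
qed

section \<open>The constraints of \<open>B\<close>, freed from product bicategories\<close>

lemma rho_iso: "X \<in> Obj B \<Longrightarrow> isomorphism B X (X \<odot> I) (\<rho> X)"
  and rho_natural: "f \<in> hom B X Y \<Longrightarrow> \<rho> Y \<cdot> f = (f \<otimes> \<one> I) \<cdot> \<rho> X"
  using natural_isomorphism.component[OF rho] natural_isomorphism.natural[OF rho] by auto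

lemma lambda_iso: "X \<in> Obj B \<Longrightarrow> isomorphism B X (I \<odot> X) (l X)"
  and lambda_natural: "f \<in> hom B X Y \<Longrightarrow> l Y \<cdot> f = (\<one> I \<otimes> f) \<cdot> l X"
  using natural_isomorphism.component[OF lambda] natural_isomorphism.natural[OF lambda] by auto

lemma gamma_iso: "\<lbrakk>X \<in> Obj B; Y \<in> Obj B\<rbrakk> \<Longrightarrow> isomorphism B (X \<odot> Y) (Y \<odot> X) (\<gamma> X Y)"
  and gamma_natural: "\<lbrakk>f \<in> hom B X X'; g \<in> hom B Y Y'\<rbrakk>
    \<Longrightarrow> \<gamma> X' Y' \<cdot> (f \<otimes> g) = (g \<otimes> f) \<cdot> \<gamma> X Y"
  using natural_isomorphism.component[OF gamma, of "(X, Y)"]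
    natural_isomorphism.natural[OF gamma, of "(f, g)" "(X, Y)" "(X', Y')"]
  by (auto simp: prod_bicat_simps)

lemma alpha_iso: "\<lbrakk>X \<in> Obj B; Y \<in> Obj B; Z \<in> Obj B\<rbrakk>
    \<Longrightarrow> isomorphism B (X \<odot> Y \<odot> Z) (X \<odot> (Y \<odot> Z)) (\<alpha> X Y Z)"
  and alpha_natural: "\<lbrakk>f \<in> hom B X X'; g \<in> hom B Y Y'; h \<in> hom B Z Z'\<rbrakk>
    \<Longrightarrow> \<alpha> X' Y' Z' \<cdot> (f \<otimes> g \<otimes> h) = (f \<otimes> (g \<otimes> h)) \<cdot> \<alpha> X Y Z"
  using natural_isomorphism.component[OF alpha, of "((X, Y), Z)"]
    natural_isomorphism.natural[OF alpha, of "((f, g), h)" "((X, Y), Z)" "((X', Y'), Z')"]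
  by (auto simp: prod_bicat_simps)

lemma monad_map_isoI:
  "\<lbrakk>monad B P; monad B Q; isomorphism B (fst P) (fst Q) f; f \<cdot> snd P = snd Q \<cdot> f\<rbrakk>
    \<Longrightarrow> monad_map P Q f"
  by (auto simp: isomorphism_def intro: monad_map_eqI)

lemmas monad_intros =
  monad_munit monad_mtensor rho_iso lambda_iso gamma_iso alpha_iso
  rho_natural lambda_natural gamma_natural alpha_natural monad_hom monad_obj

section \<open>The constraints induced on modules\<close>

definition mrho ("\<rho>\<^sub>M") where "\<rho>\<^sub>M P = sharp P (P \<odot>\<^sub>M I\<^sub>M) (\<rho> (fst P))"
definition mlambda ("l\<^sub>M") where "l\<^sub>M P = sharp P (I\<^sub>M \<odot>\<^sub>M P) (l (fst P))"
definition mgamma ("\<gamma>\<^sub>M") where "\<gamma>\<^sub>M P Q = sharp (P \<odot>\<^sub>M Q) (Q \<odot>\<^sub>M P) (\<gamma> (fst P) (fst Q))"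
definition malpha ("\<alpha>\<^sub>M") where
  "\<alpha>\<^sub>M P Q R = sharp (P \<odot>\<^sub>M Q \<odot>\<^sub>M R) (P \<odot>\<^sub>M (Q \<odot>\<^sub>M R)) (\<alpha> (fst P) (fst Q) (fst R))"

text \<open>Naturality of \<open>\<rho>\<close> at the arrow \<open>snd P\<close> is the required
  commutation, because \<open>I\<^sub>M\<close> carries the identity monad. The other constraints
  are treated alike, at the monads of their arguments.\<close>

lemma monad_map_rho: "monad B P \<Longrightarrow> monad_map P (P \<odot>\<^sub>M I\<^sub>M) (\<rho> (fst P))"
  by (rule monad_map_isoI) (auto intro: monad_intros)

lemma monad_map_lambda: "monad B P \<Longrightarrow> monad_map P (I\<^sub>M \<odot>\<^sub>M P) (l (fst P))"
  by (rule monad_map_isoI) (auto intro: monad_intros)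

lemma monad_map_gamma:
  "\<lbrakk>monad B P; monad B Q\<rbrakk> \<Longrightarrow> monad_map (P \<odot>\<^sub>M Q) (Q \<odot>\<^sub>M P) (\<gamma> (fst P) (fst Q))"
  by (rule monad_map_isoI) (auto intro: monad_intros)

lemma monad_map_alpha:
  "\<lbrakk>monad B P; monad B Q; monad B R\<rbrakk>
    \<Longrightarrow> monad_map (P \<odot>\<^sub>M Q \<odot>\<^sub>M R) (P \<odot>\<^sub>M (Q \<odot>\<^sub>M R)) (\<alpha> (fst P) (fst Q) (fst R))"
  by (rule monad_map_isoI) (auto intro: monad_intros)

lemma mrho_iso: "monad B P \<Longrightarrow> isomorphism (Mod B) P (P \<odot>\<^sub>M I\<^sub>M) (\<rho>\<^sub>M P)"
  unfolding mrho_def by (rule sharp_isomorphism) (auto intro: monad_intros)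

lemma mlambda_iso: "monad B P \<Longrightarrow> isomorphism (Mod B) P (I\<^sub>M \<odot>\<^sub>M P) (l\<^sub>M P)"
  unfolding mlambda_def by (rule sharp_isomorphism) (auto intro: monad_intros)

lemma mgamma_iso:
  "\<lbrakk>monad B P; monad B Q\<rbrakk> \<Longrightarrow> isomorphism (Mod B) (P \<odot>\<^sub>M Q) (Q \<odot>\<^sub>M P) (\<gamma>\<^sub>M P Q)"
  unfolding mgamma_def by (rule sharp_isomorphism) (auto intro: monad_intros)

lemma malpha_iso:
  "\<lbrakk>monad B P; monad B Q; monad B R\<rbrakk>
    \<Longrightarrow> isomorphism (Mod B) (P \<odot>\<^sub>M Q \<odot>\<^sub>M R) (P \<odot>\<^sub>M (Q \<odot>\<^sub>M R)) (\<alpha>\<^sub>M P Q R)"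
  unfolding malpha_def by (rule sharp_isomorphism) (auto intro: monad_intros)

section \<open>Naturality of the constraints with respect to modules\<close>

lemma module_id: "monad B P \<Longrightarrow> (P, snd P, P) \<in> hom (Mod B) P P"
  by (simp add: hom_ModI monad_hom monad_idem)

text \<open>Naturality of \<open>\<rho>\<close> is now used at the underlying arrow of the module
  \<open>x\<close> and lifted by \<open>sharp_natural\<close>; tensoring with the identity module of
  \<open>I\<^sub>M\<close> is tensoring with \<open>\<one> I\<close> underneath. The other three
  naturality proofs follow the same pattern.\<close>

lemma mrho_natural:
  assumes "x \<in> hom (Mod B) P P'"
  shows "Comp (Mod B) (\<rho>\<^sub>M P') x = Comp (Mod B) (x \<otimes>\<^sub>M Idt (Mod B) I\<^sub>M) (\<rho>\<^sub>M P)"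
  using assms
proof (rule hom_ModD)
  fix m assume m: "x = (P, m, P')" "monad B P" "monad B P'" "m \<in> hom B (fst P) (fst P')"
  show ?thesis
    using assms m module_mtensor[OF assms module_id[OF monad_munit]] rho_natural[OF m(4)]
    by (simp add: mrho_def Idt_Mod sharp_natural monad_map_rho)
qed

lemma mlambda_natural:
  assumes "x \<in> hom (Mod B) P P'"
  shows "Comp (Mod B) (l\<^sub>M P') x = Comp (Mod B) (Idt (Mod B) I\<^sub>M \<otimes>\<^sub>M x) (l\<^sub>M P)"
  using assms
proof (rule hom_ModD)
  fix m assume m: "x = (P, m, P')" "monad B P" "monad B P'" "m \<in> hom B (fst P) (fst P')"
  show ?thesis
    using assms m module_mtensor[OF module_id[OF monad_munit] assms] lambda_natural[OF m(4)]
    by (simp add: mlambda_def Idt_Mod sharp_natural monad_map_lambda)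
qed

lemma mgamma_natural:
  assumes x: "x \<in> hom (Mod B) P P'" and y: "y \<in> hom (Mod B) Q Q'"
  shows "Comp (Mod B) (\<gamma>\<^sub>M P' Q') (x \<otimes>\<^sub>M y) = Comp (Mod B) (y \<otimes>\<^sub>M x) (\<gamma>\<^sub>M P Q)"
proof -
  obtain m where m: "x = (P, m, P')" "monad B P" "monad B P'" "m \<in> hom B (fst P) (fst P')"
    using x by (elim hom_ModD)
  obtain n where n: "y = (Q, n, Q')" "monad B Q" "monad B Q'" "n \<in> hom B (fst Q) (fst Q')"
    using y by (elim hom_ModD)
  show ?thesis
    using module_mtensor[OF x y] module_mtensor[OF y x] m n gamma_natural[OF m(4) n(4)]
    by (simp add: mgamma_def sharp_natural monad_map_gamma)
qed

lemma malpha_natural: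
  assumes x: "x \<in> hom (Mod B) P P'" and y: "y \<in> hom (Mod B) Q Q'" and z: "z \<in> hom (Mod B) R R'"
  shows "Comp (Mod B) (\<alpha>\<^sub>M P' Q' R') (x \<otimes>\<^sub>M y \<otimes>\<^sub>M z)
    = Comp (Mod B) (x \<otimes>\<^sub>M (y \<otimes>\<^sub>M z)) (\<alpha>\<^sub>M P Q R)"
proof -
  obtain m where m: "x = (P, m, P')" "monad B P" "monad B P'" "m \<in> hom B (fst P) (fst P')"
    using x by (elim hom_ModD)
  obtain n where n: "y = (Q, n, Q')" "monad B Q" "monad B Q'" "n \<in> hom B (fst Q) (fst Q')"
    using y by (elim hom_ModD)
  obtain k where k: "z = (R, k, R')" "monad B R" "monad B R'" "k \<in> hom B (fst R) (fst R')"
    using z by (elim hom_ModD)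
  show ?thesis
    using module_mtensor[OF module_mtensor[OF x y] z] module_mtensor[OF x module_mtensor[OF y z]]
      m n k alpha_natural[OF m(4) n(4) k(4)]
    by (simp add: malpha_def sharp_natural monad_map_alpha)
qed

section \<open>Coherence of the constraints on modules\<close>

lemma sharp_tensor_id:
  assumes "monad_map P Q f" and "monad B R"
  shows "sharp P Q f \<otimes>\<^sub>M Idt (Mod B) R = sharp (P \<odot>\<^sub>M R) (Q \<odot>\<^sub>M R) (f \<otimes> \<one> (fst R))"
    and "Idt (Mod B) R \<otimes>\<^sub>M sharp P Q f = sharp (R \<odot>\<^sub>M P) (R \<odot>\<^sub>M Q) (\<one> (fst R) \<otimes> f)"
  using assms sharp_tensor[OF assms(1) monad_map_id] sharp_tensor[OF monad_map_id assms(1)]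
  by (simp_all add: sharp_id)

lemma monad_map_tensor_id:
  assumes "monad_map P Q f" and "monad B R"
  shows "monad_map (P \<odot>\<^sub>M R) (Q \<odot>\<^sub>M R) (f \<otimes> \<one> (fst R))"
    and "monad_map (R \<odot>\<^sub>M P) (R \<odot>\<^sub>M Q) (\<one> (fst R) \<otimes> f)"
  using assms by (auto intro: monad_map_tensor monad_map_id)

text \<open>Identity modules are \<open>sharp\<close> of identities, so every factor is
  \<open>sharp\<close> of its counterpart in \<open>B\<close>. Each side collapses to a single
  \<open>sharp\<close>, and the pentagon in \<open>B\<close> identifies the two. The remaining
  coherence equations are transported in the same way.\<close>

lemma mpentagon:
  assumes P: "monad B P" and Q: "monad B Q" and R: "monad B R" and S: "monad B S"
  shows "Comp (Mod B) (\<alpha>\<^sub>M P Q (R \<odot>\<^sub>M S)) (\<alpha>\<^sub>M (P \<odot>\<^sub>M Q) R S) =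
    Comp (Mod B) (Comp (Mod B) (Idt (Mod B) P \<otimes>\<^sub>M \<alpha>\<^sub>M Q R S) (\<alpha>\<^sub>M P (Q \<odot>\<^sub>M R) S))
      (\<alpha>\<^sub>M P Q R \<otimes>\<^sub>M Idt (Mod B) S)"
  using pentagon[OF assms[THEN monad_obj]]
    sharp_comp[OF monad_map_alpha[OF monad_mtensor[OF P Q] R S]
      monad_map_alpha[OF P Q monad_mtensor[OF R S]]]
    sharp_comp3[OF monad_map_tensor_id(1)[OF monad_map_alpha[OF P Q R] S]
      monad_map_alpha[OF P monad_mtensor[OF Q R] S]
      monad_map_tensor_id(2)[OF monad_map_alpha[OF Q R S] P]]
    sharp_tensor_id[OF monad_map_alpha[OF P Q R] S]
    sharp_tensor_id[OF monad_map_alpha[OF Q R S] P]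
  by (simp add: malpha_def)

lemma mtriangle:
  assumes P: "monad B P" and Q: "monad B Q"
  shows "Comp (Mod B) (\<alpha>\<^sub>M P I\<^sub>M Q) (\<rho>\<^sub>M P \<otimes>\<^sub>M Idt (Mod B) Q) = Idt (Mod B) P \<otimes>\<^sub>M l\<^sub>M Q"
  using triangle[OF assms[THEN monad_obj]]
    sharp_comp[OF monad_map_tensor_id(1)[OF monad_map_rho[OF P] Q]
      monad_map_alpha[OF P monad_munit Q]]
    sharp_tensor_id[OF monad_map_rho[OF P] Q] sharp_tensor_id[OF monad_map_lambda[OF Q] P]
  by (simp add: malpha_def mrho_def mlambda_def)

lemma mhexagon:
  assumes P: "monad B P" and Q: "monad B Q" and R: "monad B R"
  shows "Comp (Mod B) (Comp (Mod B) (\<alpha>\<^sub>M Q R P) (\<gamma>\<^sub>M P (Q \<odot>\<^sub>M R))) (\<alpha>\<^sub>M P Q R) =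
    Comp (Mod B) (Comp (Mod B) (Idt (Mod B) Q \<otimes>\<^sub>M \<gamma>\<^sub>M P R) (\<alpha>\<^sub>M Q P R))
      (\<gamma>\<^sub>M P Q \<otimes>\<^sub>M Idt (Mod B) R)"
  using hexagon[OF assms[THEN monad_obj]]
    sharp_comp3[OF monad_map_alpha[OF P Q R] monad_map_gamma[OF P monad_mtensor[OF Q R]]
      monad_map_alpha[OF Q R P]]
    sharp_comp3[OF monad_map_tensor_id(1)[OF monad_map_gamma[OF P Q] R]
      monad_map_alpha[OF Q P R] monad_map_tensor_id(2)[OF monad_map_gamma[OF P R] Q]]
    sharp_tensor_id[OF monad_map_gamma[OF P Q] R]
    sharp_tensor_id[OF monad_map_gamma[OF P R] Q]
  by (simp add: malpha_def mgamma_def)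

lemma msymmetry:
  assumes P: "monad B P" and Q: "monad B Q"
  shows "Comp (Mod B) (\<gamma>\<^sub>M Q P) (\<gamma>\<^sub>M P Q) = Idt (Mod B) (P \<odot>\<^sub>M Q)"
  using symmetry[OF assms[THEN monad_obj]]
    sharp_comp[OF monad_map_gamma[OF P Q] monad_map_gamma[OF Q P]]
    sharp_id[OF monad_mtensor[OF P Q]]
  by (simp add: mgamma_def)

lemma tensor_product_Mod:
  "tensor_product (Mod B) (\<odot>\<^sub>M) (\<otimes>\<^sub>M) I\<^sub>M \<rho>\<^sub>M l\<^sub>M \<gamma>\<^sub>M \<alpha>\<^sub>M"
proof -
  \<comment> \<open>This supplies, over \<open>Mod B\<close>, the pseudofunctors between which the
    four natural isomorphisms run.\<close>
  interpret M: bifunctor "Mod B" "(\<odot>\<^sub>M)" "(\<otimes>\<^sub>M)"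
    by (rule bifunctor_Mod)
  have unit: "I\<^sub>M \<in> Obj (Mod B)"
    by (simp add: Obj_Mod monad_munit)
  show ?thesis
    by (intro tensor_product.intro tensor_product_axioms.intro natural_isomorphism.intro
        natural_isomorphism_axioms.intro M.locally_ordered_bicategory_axioms
        M.tensor_pseudofunctor M.pseudofunctor_id M.pseudofunctor_tensor_right[OF unit]
        M.pseudofunctor_tensor_left[OF unit] M.pseudofunctor_tensor_swap
        M.pseudofunctor_tensor_left_nested M.pseudofunctor_tensor_right_nested unit)
      (auto simp: prod_bicat_simps Obj_Mod mpentagon mtriangle mhexagon msymmetry
        intro: mrho_iso mlambda_iso mgamma_iso malpha_iso
          mrho_natural mlambda_natural mgamma_natural malpha_natural)
qed

end


section \<open>The Cartesian structure on modules\<close>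

context cartesian_structure
begin

definition md ("d\<^sub>M") where "d\<^sub>M P = sharp P (P \<odot>\<^sub>M P) (d (fst P))"
definition mt ("t\<^sub>M") where "t\<^sub>M P = sharp P I\<^sub>M (t (fst P))"

text \<open>This is \<open>d_lax\<close> at the arrow \<open>snd P\<close>. Unlike for the
  constraints, only an inequality is available, which is why maps of monads are lax.\<close>

lemma monad_map_d: "monad B P \<Longrightarrow> monad_map P (P \<odot>\<^sub>M P) (d (fst P))"
  by (auto simp: monad_map_def intro: monad_mtensor d_hom d_lax monad_obj monad_hom)

lemma monad_map_t: "monad B P \<Longrightarrow> monad_map P I\<^sub>M (t (fst P))"
  \<comment> \<open>The target monad is the identity of \<open>I\<close>, so the bound to be shown
    is \<open>t_lax\<close> at \<open>snd P\<close>.\<close>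
  using comp_id_left[OF t_hom[OF monad_obj]]
  by (auto simp: monad_map_def intro: monad_munit t_hom t_lax monad_obj monad_hom)

lemma md_hom: "monad B P \<Longrightarrow> d\<^sub>M P \<in> hom (Mod B) P (P \<odot>\<^sub>M P)"
  unfolding md_def by (intro sharp_hom monad_map_d)

lemma mt_hom: "monad B P \<Longrightarrow> t\<^sub>M P \<in> hom (Mod B) P I\<^sub>M"
  unfolding mt_def by (intro sharp_hom monad_map_t)

lemma mcoassociative:
  assumes P: "monad B P"
  shows "Comp (Mod B) (Idt (Mod B) P \<otimes>\<^sub>M d\<^sub>M P) (d\<^sub>M P) =
    Comp (Mod B) (Comp (Mod B) (\<alpha>\<^sub>M P P P) (d\<^sub>M P \<otimes>\<^sub>M Idt (Mod B) P)) (d\<^sub>M P)"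
  using coassociative[OF monad_obj[OF P]] sharp_tensor_id[OF monad_map_d[OF P] P]
    sharp_comp[OF monad_map_d[OF P] monad_map_tensor_id(2)[OF monad_map_d[OF P] P]]
    sharp_comp3[OF monad_map_d[OF P] monad_map_tensor_id(1)[OF monad_map_d[OF P] P]
      monad_map_alpha[OF P P P]]
  by (simp add: md_def malpha_def)

lemma mcounit:
  assumes P: "monad B P"
  shows "Comp (Mod B) (Idt (Mod B) P \<otimes>\<^sub>M t\<^sub>M P) (d\<^sub>M P) = \<rho>\<^sub>M P"
    and "Comp (Mod B) (t\<^sub>M P \<otimes>\<^sub>M Idt (Mod B) P) (d\<^sub>M P) = l\<^sub>M P"
  using counit_right[OF monad_obj[OF P]] counit_left[OF monad_obj[OF P]]
    sharp_tensor_id[OF monad_map_t[OF P] P]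
    sharp_comp[OF monad_map_d[OF P] monad_map_tensor_id(1)[OF monad_map_t[OF P] P]]
    sharp_comp[OF monad_map_d[OF P] monad_map_tensor_id(2)[OF monad_map_t[OF P] P]]
  by (simp_all add: md_def mt_def mrho_def mlambda_def)

lemma mcocommutative: "monad B P \<Longrightarrow> Comp (Mod B) (\<gamma>\<^sub>M P P) (d\<^sub>M P) = d\<^sub>M P"
  using sharp_comp[OF monad_map_d monad_map_gamma]
  by (simp add: md_def mgamma_def cocommutative monad_obj)

text \<open>An instance of \<open>sharp_lax\<close>, with \<open>d_lax\<close> at the underlying
  arrow \<open>m\<close> as the 2-cell and \<open>m \<otimes> m\<close> as the second
  module.\<close>

lemma md_lax:
  assumes x: "x \<in> hom (Mod B) P Q"
  shows "Le (Mod B) (Comp (Mod B) (d\<^sub>M Q) x) (Comp (Mod B) (x \<otimes>\<^sub>M x) (d\<^sub>M P))"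
proof -
  obtain m where m: "x = (P, m, Q)" "monad B P" "monad B Q" "m \<in> hom B (fst P) (fst Q)"
    using x by (elim hom_ModD)
  show ?thesis
    using x module_mtensor[OF x x] m d_lax[OF m(4)]
    by (simp add: md_def sharp_lax monad_map_d)
qed

text \<open>Since \<open>I\<^sub>M\<close> carries the identity monad, the underlying arrows reduce
  to \<open>t (fst Q) \<cdot> m\<close> and \<open>t (fst P)\<close>, and \<open>t_lax\<close>
  compares them directly.\<close>

lemma mt_lax:
  assumes x: "x \<in> hom (Mod B) P Q"
  shows "Le (Mod B) (Comp (Mod B) (t\<^sub>M Q) x) (t\<^sub>M P)"
proof -
  obtain m where m: "x = (P, m, Q)" "monad B P" "monad B Q" "m \<in> hom B (fst P) (fst Q)"
    using x by (elim hom_ModD)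
  have t: "t (fst P) \<in> hom B (fst P) I" "t (fst Q) \<in> hom B (fst Q) I"
    using m by (auto intro: t_hom monad_obj)
  show ?thesis
    using m t_lax[OF m(4)] comp_id_left[OF t(1)] comp_id_left[OF t(2)]
    by (simp add: mt_def sharp_def Comp_Mod Le_Mod)
qed

lemma cartesian_structure_Mod:
  "cartesian_structure (Mod B) (\<odot>\<^sub>M) (\<otimes>\<^sub>M) I\<^sub>M \<rho>\<^sub>M l\<^sub>M \<gamma>\<^sub>M \<alpha>\<^sub>M d\<^sub>M t\<^sub>M"
proof (intro cartesian_structure.intro cartesian_structure_axioms.intro tensor_product_Mod)
  fix P assume "P \<in> Obj (Mod B)"
  then have P: "monad B P"
    by (simp add: Obj_Mod)
  obtain g h where "right_adjoint B (fst P) (fst P \<odot> fst P) (d (fst P)) g"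
    "right_adjoint B (fst P) I (t (fst P)) h"
    using d_right_adjoint t_right_adjoint monad_obj[OF P] by blast
  \<comment> \<open>The witnesses have underlying arrows
    \<open>g \<cdot> snd (P \<odot>\<^sub>M P)\<close> and \<open>h \<cdot> snd I\<^sub>M\<close>,
    as given by \<open>sharp_right_adjoint\<close>.\<close>
  then show "\<exists>g. right_adjoint (Mod B) P (P \<odot>\<^sub>M P) (d\<^sub>M P) g"
    "\<exists>g. right_adjoint (Mod B) P I\<^sub>M (t\<^sub>M P) g"
    using sharp_right_adjoint[OF monad_map_d[OF P]] sharp_right_adjoint[OF monad_map_t[OF P]]
    unfolding md_def mt_def mtensor_obj_simps munit_simps by blast+
qed (auto simp: Obj_Mod mcoassociative mcounit mcocommutative
    intro: md_hom mt_hom md_lax mt_lax)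

end

theorem theorem2p3p1:
  fixes B :: "('o, 'a) bicat"
  assumes "locally_ordered_cartesian_bicategory B"
  shows "locally_ordered_cartesian_bicategory (Mod B)"
proof -
  obtain tensor_obj tensor_arr I \<rho> l \<gamma> \<alpha> d t where
    "cartesian_structure B tensor_obj tensor_arr I \<rho> l \<gamma> \<alpha> d t"
    using assms unfolding locally_ordered_cartesian_bicategory_def by blast
  then interpret cartesian_structure B tensor_obj tensor_arr I \<rho> l \<gamma> \<alpha> d t .
  show ?thesis
    using locally_ordered_bicategory_Mod cartesian_structure_Mod
    unfolding locally_ordered_cartesian_bicategory_def by blast
qed

end
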